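(* Let $P_{YZ}$ be a joint probability distribution of random variables $Y,Z$ with finite alphabets, let $\varepsilon\in[0,1)$, and let $K>0$. Then $$K\le\min_{\eta\in(0,1-\varepsilon]}\frac1\eta\,\beta_{\varepsilon+\eta}(P_{YZ},\mathbb 1_Y\times P_Z)\qquad\Longleftrightarrow\qquad \varepsilon\ge E_{|Y|/K}(P_{YZ},R_Y\times P_Z).$$ That is, the two converse bounds on the size $K$ of the output of a privacy amplification protocol with error $\varepsilon$ given by the two sides are equivalent.
   Context: All alphabets are finite, and probability mass functions are regarded as real vectors; $|Y|$ denotes the alphabet size of $Y$. $\mathbb 1$ is the all-ones vector, $R_Y$ is the uniform distribution on the alphabet of $Y$, $\times$ is the product (tensor product of vectors), so $(\mathbb 1_Y\times P_Z)(y,z)=P_Z(z)$. $P_Z$ is the marginal of $P_{YZ}$. For a probability vector $P$, a nonnegative vector $Q$ (not necessarily normalized) and $\alpha\in[0,1]$, $$\beta_\alpha(P,Q):=\min_\Lambda\{\langle\Lambda,Q\rangle:\langle\Lambda,P\rangle\ge\alpha,\ 0\le\Lambda\le\mathbb 1\},$$ with $\langle\cdot,\cdot\rangle$ the Euclidean inner product and inequalities entrywise. For $\gamma>0$ and probability vectors $P,Q$, with $A_\gamma=\{x:P(x)\ge\gamma Q(x)\}$, $$E_\gamma(P,Q):=P[A_\gamma]-\gamma\,Q[A_\gamma]=\max_{0\le\Lambda\le\mathbb 1}\big(\langle\Lambda,P\rangle-\gamma\langle\Lambda,Q\rangle\big).$$ *)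

theory Defs
  imports "HOL-Probability.Probability"
begin

definition inner_prod :: "('a::finite \<Rightarrow> real) \<Rightarrow> ('a \<Rightarrow> real) \<Rightarrow> real" where
  "inner_prod u v = (\<Sum>x\<in>UNIV. u x * v x)"

definition tensor :: "('a \<Rightarrow> real) \<Rightarrow> ('b \<Rightarrow> real) \<Rightarrow> 'a \<times> 'b \<Rightarrow> real" where
  "tensor u v = (\<lambda>(a, b). u a * v b)"

definition tests :: "real \<Rightarrow> ('a::finite \<Rightarrow> real) \<Rightarrow> ('a \<Rightarrow> real) set" where
  "tests \<alpha> P = {\<Lambda>. inner_prod \<Lambda> P \<ge> \<alpha> \<and> (\<forall>x. 0 \<le> \<Lambda> x \<and> \<Lambda> x \<le> 1)}"

text \<open>
  The binder LEAST over a set of reals is its minimum, not merely its infimum. It is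
  meaningful only if the minimum is attained; for a probability vector \<open>P\<close> and
  \<open>\<alpha> \<le> 1\<close> this is the lemma \<open>beta_minimum\<close> below.
\<close>

definition beta :: "real \<Rightarrow> ('a::finite \<Rightarrow> real) \<Rightarrow> ('a \<Rightarrow> real) \<Rightarrow> real" where
  "beta \<alpha> P Q = (LEAST b. b \<in> (\<lambda>\<Lambda>. inner_prod \<Lambda> Q) ` tests \<alpha> P)"

definition E_gamma :: "real \<Rightarrow> 'a pmf \<Rightarrow> 'a pmf \<Rightarrow> real" where
  "E_gamma \<gamma> P Q =
     (let A = {x. pmf P x \<ge> \<gamma> * pmf Q x}
      in measure_pmf.prob P A - \<gamma> * measure_pmf.prob Q A)"

lemma beta_minimum:
  fixes P :: "'a::finite pmf" and Q :: "'a \<Rightarrow> real"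
  assumes "\<alpha> \<le> 1"
  obtains \<Lambda> where "\<Lambda> \<in> tests \<alpha> (pmf P)" "beta \<alpha> (pmf P) Q = inner_prod \<Lambda> Q"
    "\<And>M. M \<in> tests \<alpha> (pmf P) \<Longrightarrow> beta \<alpha> (pmf P) Q \<le> inner_prod M Q"
proof -
  define C where "C = cbox (0 :: real ^ 'a) (\<chi> i. 1) \<inter> {v. \<alpha> \<le> inner_prod (($) v) (pmf P)}"
  have cont: "continuous_on S (\<lambda>v :: real ^ 'a. inner_prod (($) v) w)" for S w
    unfolding inner_prod_def by (intro continuous_intros)
  have "closed {v :: real ^ 'a. \<alpha> \<le> inner_prod (($) v) (pmf P)}"
    by (intro closed_Collect_le continuous_on_const cont)
  then have "compact C"
    unfolding C_def by (intro compact_Int_closed compact_cbox)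
  moreover have C_iff: "v \<in> C \<longleftrightarrow> ($) v \<in> tests \<alpha> (pmf P)" for v
    by (auto simp: C_def tests_def mem_box_cart)
  have "(\<chi> i. 1) \<in> C"
    using assms by (simp add: C_iff tests_def inner_prod_def sum_pmf_eq_1)
  ultimately obtain v where v: "v \<in> C"
    "\<And>w. w \<in> C \<Longrightarrow> inner_prod (($) v) Q \<le> inner_prod (($) w) Q"
    using continuous_attains_inf[OF _ _ cont, of C Q] by blast
  have le: "inner_prod (($) v) Q \<le> inner_prod M Q" if "M \<in> tests \<alpha> (pmf P)" for M
    using v(2)[of "vec_lambda M"] that by (simp add: C_iff vec_lambda_inverse)
  have eq: "beta \<alpha> (pmf P) Q = inner_prod (($) v) Q"
    unfolding beta_def using v(1) le by (intro Least_equality) (auto simp: C_iff)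
  show ?thesis
    using that[of "($) v"] v(1) le eq by (simp add: C_iff)
qed

end

theory Submission imports Defs begin

text \<open>
  A linear functional on \<open>0 \<le> \<Lambda> \<le> 1\<close> is maximized by the indicator of the set where its
  coefficients are nonnegative, so both sides reduce to the finitely many inequalities
  \<open>K * (P A - \<epsilon>) \<le> Q A\<close> over sets \<open>A\<close>, where \<open>Q = 1 \<times> P\<^sub>Z\<close>. The minimum over \<open>\<eta>\<close> is the least
  ratio \<open>Q A / (P A - \<epsilon>)\<close> over the sets with \<open>P A > \<epsilon>\<close>; it is attained at \<open>\<eta> = P A - \<epsilon>\<close>, also
  for \<open>\<epsilon> = 0\<close>, where the range of \<open>\<eta>\<close> is not compact.
\<close>

lemma inner_prod_le_sum_nonneg:
  assumes "\<And>x. 0 \<le> \<Lambda> x" "\<And>x. \<Lambda> x \<le> 1"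
  shows "inner_prod \<Lambda> w \<le> sum w {x. 0 \<le> w x}"
proof -
  have "inner_prod \<Lambda> w \<le> (\<Sum>x\<in>UNIV. if 0 \<le> w x then w x else 0)"
    unfolding inner_prod_def
    using assms by (intro sum_mono) (auto intro: mult_left_le_one_le mult_nonneg_nonpos)
  then show ?thesis
    by (simp add: sum.If_cases)
qed

lemma inner_prod_indicator: "inner_prod (indicat_real A) w = sum w A"
  by (simp add: inner_prod_def indicator_def if_distrib if_distribR sum.If_cases cong: if_cong)

text \<open>Passes from sets to arbitrary tests: the difference of the two sides is linear in
  \<open>\<Lambda>\<close> up to a constant, so the worst case is the indicator of the set where
  \<open>k * P x - Q x\<close> is nonnegative.\<close>

lemma test_bound_if_set_bound:
  fixes P Q :: "'a::finite \<Rightarrow> real"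
  assumes "\<And>A. k * (sum P A - e) \<le> sum Q A"
    and "\<And>x. 0 \<le> \<Lambda> x" "\<And>x. \<Lambda> x \<le> 1"
  shows "k * (inner_prod \<Lambda> P - e) \<le> inner_prod \<Lambda> Q"
proof -
  define w where "w = (\<lambda>x. k * P x - Q x)"
  have "k * inner_prod \<Lambda> P - inner_prod \<Lambda> Q = inner_prod \<Lambda> w"
    by (simp add: inner_prod_def w_def right_diff_distrib sum_subtractf sum_distrib_left mult.left_commute)
  also have "\<dots> \<le> sum w {x. 0 \<le> w x}"
    by (rule inner_prod_le_sum_nonneg[OF assms(2,3)])
  also have "\<dots> \<le> k * e"
    using assms(1)[of "{x. 0 \<le> w x}"]
    by (simp add: w_def sum_subtractf right_diff_distrib sum_distrib_left)
  finally show ?thesis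
    by (simp add: right_diff_distrib)
qed

lemma le_beta_ratio_minimum_iff:
  fixes P :: "'a::finite pmf" and Q :: "'a \<Rightarrow> real"
  assumes Q: "\<And>x. 0 \<le> Q x" and e: "0 \<le> e" "e < 1" and "0 < k"
  shows "k \<le> (LEAST m. m \<in> (\<lambda>\<eta>. 1 / \<eta> * beta (e + \<eta>) (pmf P) Q) ` {0<..1 - e})
    \<longleftrightarrow> (\<forall>A. k * (sum (pmf P) A - e) \<le> sum Q A)"
proof -
  define S where "S = {A. e < sum (pmf P) A}"
  define r where "r A = sum Q A / (sum (pmf P) A - e)" for A
  \<comment> \<open>Since \<open>e < 1\<close>, the minimum below ranges over a nonempty finite
    set.\<close>
  have "UNIV \<in> S"
    using e by (simp add: S_def sum_pmf_eq_1)
  then have "Min (r ` S) \<in> r ` S"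
    by (intro Min_in) auto
  then obtain A where A: "A \<in> S" "Min (r ` S) = r A"
    by auto
  then have min: "r A \<le> r B" if "B \<in> S" for B
    using that by (metis Min_le finite finite_imageI imageI)
  \<comment> \<open>Kept general in \<open>c\<close> for two uses: \<open>c = r A\<close> gives the
    lower bound on \<open>beta\<close>, \<open>c = k\<close> gives the conclusion. Sets outside
    \<open>S\<close> impose no constraint, as their left side is nonpositive.\<close>
  have iff: "c \<le> r A \<longleftrightarrow> (\<forall>B. c * (sum (pmf P) B - e) \<le> sum Q B)" if "0 \<le> c" for c
  proof (intro iffI allI)
    fix B assume c: "c \<le> r A"
    show "c * (sum (pmf P) B - e) \<le> sum Q B"
    proof (cases "B \<in> S")
      case True
      then have "c \<le> r B"
        using c min by fastforce
      then show ?thesis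
        using True by (simp add: r_def S_def pos_le_divide_eq)
    next
      case False
      then have "c * (sum (pmf P) B - e) \<le> 0"
        using that by (simp add: S_def mult_nonneg_nonpos)
      also have "0 \<le> sum Q B"
        by (simp add: Q sum_nonneg)
      finally show ?thesis .
    qed
  next
    assume "\<forall>B. c * (sum (pmf P) B - e) \<le> sum Q B"
    then show "c \<le> r A"
      using A(1) by (simp add: r_def S_def pos_le_divide_eq)
  qed
  have r0: "0 \<le> r A"
    using A(1) by (simp add: r_def S_def Q sum_nonneg)
  \<comment> \<open>Every feasible test has \<open>P\<close>-value at least
    \<open>e + \<eta>\<close>, so the set inequalities with constant \<open>r A\<close>, extended to
    tests, bound its \<open>Q\<close>-value.\<close>
  have lower: "r A * \<eta> \<le> beta (e + \<eta>) (pmf P) Q" if "\<eta> \<in> {0<..1 - e}" for \<eta>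
  proof -
    from that have "e + \<eta> \<le> 1"
      by simp
    then obtain \<Lambda> where \<Lambda>: "\<Lambda> \<in> tests (e + \<eta>) (pmf P)"
      "beta (e + \<eta>) (pmf P) Q = inner_prod \<Lambda> Q"
      by (rule beta_minimum)
    have "r A * \<eta> \<le> r A * (inner_prod \<Lambda> (pmf P) - e)"
      using \<Lambda>(1) r0 by (intro mult_left_mono) (auto simp: tests_def)
    also have "\<dots> \<le> inner_prod \<Lambda> Q"
      using iff[OF r0] \<Lambda>(1) by (intro test_bound_if_set_bound) (auto simp: tests_def)
    finally show ?thesis
      using \<Lambda>(2) by simp
  qed
  \<comment> \<open>The largest \<open>\<eta>\<close> for which the indicator of \<open>A\<close> is
    still feasible; its \<open>Q\<close>-value is exactly \<open>r A * \<eta>\<close>, matching the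
    lower bound.\<close>
  define \<eta> where "\<eta> = sum (pmf P) A - e"
  have "sum (pmf P) A \<le> sum (pmf P) UNIV"
    by (intro sum_mono2) auto
  then have \<eta>: "\<eta> \<in> {0<..1 - e}"
    using A(1) by (simp add: \<eta>_def S_def sum_pmf_eq_1)
  then have "e + \<eta> \<le> 1"
    by simp
  moreover have "indicat_real A \<in> tests (e + \<eta>) (pmf P)"
    by (simp add: tests_def inner_prod_indicator \<eta>_def)
  ultimately have "beta (e + \<eta>) (pmf P) Q \<le> inner_prod (indicat_real A) Q"
    using beta_minimum by metis
  also have "\<dots> = r A * \<eta>"
    using \<eta> by (simp add: inner_prod_indicator r_def \<eta>_def)
  finally have "1 / \<eta> * beta (e + \<eta>) (pmf P) Q = r A"
    using lower[OF \<eta>] \<eta> by (simp add: field_simps)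
  then have "(LEAST m. m \<in> (\<lambda>\<eta>. 1 / \<eta> * beta (e + \<eta>) (pmf P) Q) ` {0<..1 - e}) = r A"
    using \<eta> lower by (intro Least_equality) (auto simp: pos_le_divide_eq intro!: image_eqI[of _ _ \<eta>])
  then show ?thesis
    using iff[of k] \<open>0 < k\<close> by simp
qed

text \<open>The set defining \<open>E_gamma\<close> is where \<open>w\<close> is nonnegative, and
  this set maximizes \<open>sum w\<close> over all sets.\<close>

lemma E_gamma_le_iff:
  fixes P Q :: "'a::finite pmf"
  shows "E_gamma \<gamma> P Q \<le> e \<longleftrightarrow> (\<forall>A. sum (pmf P) A - \<gamma> * sum (pmf Q) A \<le> e)"
proof -
  define w where "w = (\<lambda>x. pmf P x - \<gamma> * pmf Q x)"
  have w: "sum w A = sum (pmf P) A - \<gamma> * sum (pmf Q) A" for A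
    by (simp add: w_def sum_subtractf sum_distrib_left)
  have E: "E_gamma \<gamma> P Q = sum w {x. 0 \<le> w x}"
    unfolding w by (simp add: E_gamma_def Let_def measure_measure_pmf_finite w_def)
  have "sum w A \<le> E_gamma \<gamma> P Q" for A
    using inner_prod_le_sum_nonneg[of "indicat_real A" w] by (simp add: E inner_prod_indicator)
  then show ?thesis
    unfolding w[symmetric] using E order_trans by auto
qed

theorem proposition1:
  fixes P :: "('y::finite \<times> 'z::finite) pmf" and \<epsilon> K :: real
  assumes "0 \<le> \<epsilon>" and "\<epsilon> < 1" and "K > 0"
  shows "K \<le> (LEAST m. m \<in> (\<lambda>\<eta>. 1 / \<eta> * beta (\<epsilon> + \<eta>) (pmf P)
                                 (tensor (\<lambda>_. 1) (pmf (map_pmf snd P)))) ` {0<..1 - \<epsilon>})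
         \<longleftrightarrow> \<epsilon> \<ge> E_gamma (real CARD('y) / K) P
                    (pair_pmf (pmf_of_set (UNIV :: 'y set)) (map_pmf snd P))"
proof -
  define Q :: "'y \<times> 'z \<Rightarrow> real" where "Q = tensor (\<lambda>_. 1) (pmf (map_pmf snd P))"
  define R where "R = pair_pmf (pmf_of_set (UNIV :: 'y set)) (map_pmf snd P)"
  \<comment> \<open>The uniform factor contributes \<open>1 / CARD('y)\<close>, which the choice of
    \<open>\<gamma>\<close> cancels; what remains is the set inequality divided by
    \<open>K\<close>.\<close>
  have "pmf R x = Q x / CARD('y)" for x
    by (cases x) (simp add: R_def Q_def tensor_def pmf_pair)
  then have R: "real CARD('y) / K * sum (pmf R) A = sum Q A / K" for A
    by (simp flip: sum_divide_distrib)
  have "0 \<le> Q x" for x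
    by (simp add: Q_def tensor_def split: prod.split)
  from le_beta_ratio_minimum_iff[OF this assms]
  have "K \<le> (LEAST m. m \<in> (\<lambda>\<eta>. 1 / \<eta> * beta (\<epsilon> + \<eta>) (pmf P) Q) ` {0<..1 - \<epsilon>})
    \<longleftrightarrow> (\<forall>A. K * (sum (pmf P) A - \<epsilon>) \<le> sum Q A)" .
  also have "\<dots> \<longleftrightarrow> E_gamma (real CARD('y) / K) P R \<le> \<epsilon>"
    unfolding E_gamma_le_iff R using \<open>K > 0\<close> by (simp add: field_simps)
  finally show ?thesis
    unfolding Q_def R_def .
qed

end
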